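(* (Lipschitz category.) Let $X$ be a nonempty separable metric space. The following conditions are equivalent: (1) $\dim_{AN}(X)\le 0$; (2) there exists a number $\lambda$ such that every nonempty closed subset of $X$ is a $\lambda$-Lipschitz retract of $X$; (3) there exists a number $\lambda$ such that every metric space is a $\lambda\times$-Lipschitz extensor for $X$; (4) the unit $0$-sphere $S^0$ is a Lipschitz extensor for $X$. (Proper Lipschitz category.) Let $X$ be an unbounded separable metric space. The following conditions are equivalent: (1) $\dim_{AN}(X)\le 0$; (2) there exists a number $\lambda$ such that for every unbounded closed subset $A$ of $X$ there is a metrically proper $\lambda$-Lipschitz retraction $X\to A$; (3) there exists a number $\lambda$ such that for every unbounded metric space $Y$ and every unbounded closed subset $A\subset X$, any metrically proper Lipschitz map $f\colon A\to Y$ extends to a metrically proper Lipschitz map $F\colon X\to Y$ with $\mathrm{Lip}(F)\le\lambda\cdot\mathrm{Lip}(f)$.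
   Context: For $S>0$, an $S$-chain in a metric space $X$ is a finite sequence $x_1,\dots,x_k$ with $d(x_i,x_{i+1})\le S$ for all $i<k$. A subset is $S$-connected if any two of its points can be joined by an $S$-chain inside the subset; $S$-components of $X$ are maximal $S$-connected subsets. A subset is $D$-bounded if any two of its points are at distance $\le D$. $X$ has Assouad–Nagata dimension zero, $\dim_{AN}(X)\le 0$, if there is a constant $m\ge1$ such that for every $S>0$ all $S$-components of $X$ are $mS$-bounded. A map $f\colon X\to Y$ is $\lambda$-Lipschitz if $d_Y(f(x),f(x'))\le\lambda d_X(x,x')$ for all $x,x'$, and Lipschitz if it is $\lambda$-Lipschitz for some $\lambda>0$; $\mathrm{Lip}(f)=\inf\{\lambda\mid f\text{ is }\lambda\text{-Lipschitz}\}$. A $\lambda$-Lipschitz retract of $X$ is a subset $A$ for which there is a $\lambda$-Lipschitz map $r\colon X\to A$ with $r|_A=\mathrm{id}_A$ (a retraction). A metric space $K$ is an $m\times$-Lipschitz extensor for a metric space $X$ ($m>0$) if for every nonempty closed $A\subset X$ every Lipschitz map $f\colon A\to K$ extends to a Lipschitz map $F\colon X\to K$ with $\mathrm{Lip}(F)\le m\cdot\mathrm{Lip}(f)$. $K$ is a Lipschitz extensor for $X$ if it is an $m\times$-Lipschitz extensor for $X$ for some constant $m>0$. $S^0=\{-1,1\}\subset\mathbb{R}$ with the induced metric. A map is metrically proper if preimages of bounded sets are bounded. The Lipschitz category consists of separable metric spaces and Lipschitz maps; the Proper Lipschitz category is its subcategory of unbounded spaces and metrically proper Lipschitz maps. 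*)

theory Defs
  imports "HOL-Analysis.Analysis"
begin

section \<open>Chains, components and Assouad--Nagata dimension zero\<close>

definition bounded_by :: "'a metric \<Rightarrow> real \<Rightarrow> 'a set \<Rightarrow> bool" where
  "bounded_by X D U \<longleftrightarrow> U \<subseteq> mspace X \<and> (\<forall>x\<in>U. \<forall>y\<in>U. mdist X x y \<le> D)"

definition chain_joins :: "'a metric \<Rightarrow> real \<Rightarrow> 'a set \<Rightarrow> 'a \<Rightarrow> 'a \<Rightarrow> bool" where
  "chain_joins X S U x y \<longleftrightarrow>
     (\<exists>xs. xs \<noteq> [] \<and> set xs \<subseteq> U \<and> hd xs = x \<and> last xs = y \<and>
           successively (\<lambda>u v. mdist X u v \<le> S) xs)"

definition scale_connected :: "'a metric \<Rightarrow> real \<Rightarrow> 'a set \<Rightarrow> bool" where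
  "scale_connected X S U \<longleftrightarrow> U \<subseteq> mspace X \<and> (\<forall>x\<in>U. \<forall>y\<in>U. chain_joins X S U x y)"

definition scale_component :: "'a metric \<Rightarrow> real \<Rightarrow> 'a set \<Rightarrow> bool" where
  "scale_component X S U \<longleftrightarrow>
     scale_connected X S U \<and> (\<forall>V. scale_connected X S V \<and> U \<subseteq> V \<longrightarrow> V = U)"

definition AN_dim_le_0 :: "'a metric \<Rightarrow> bool" where
  "AN_dim_le_0 X \<longleftrightarrow>
     (\<exists>m\<ge>1. \<forall>S>0. \<forall>U. scale_component X S U \<longrightarrow> bounded_by X (m * S) U)"

section \<open>Lipschitz maps, retracts and extensors\<close>

text \<open>As in the library's \<open>lipschitz_on\<close>, Lipschitz constants are nonnegative; without this the
  infimum below would be taken over all reals when the domain is a single point.\<close>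

definition lipschitz_map :: "real \<Rightarrow> 'a metric \<Rightarrow> 'b metric \<Rightarrow> ('a \<Rightarrow> 'b) \<Rightarrow> bool" where
  "lipschitz_map L X Y f \<longleftrightarrow>
     0 \<le> L \<and> f \<in> mspace X \<rightarrow> mspace Y \<and>
     (\<forall>x\<in>mspace X. \<forall>y\<in>mspace X. mdist Y (f x) (f y) \<le> L * mdist X x y)"

definition Lip :: "'a metric \<Rightarrow> 'b metric \<Rightarrow> ('a \<Rightarrow> 'b) \<Rightarrow> real" where
  "Lip X Y f = Inf {L. lipschitz_map L X Y f}"

definition lipschitz_retraction :: "real \<Rightarrow> 'a metric \<Rightarrow> 'a set \<Rightarrow> ('a \<Rightarrow> 'a) \<Rightarrow> bool" where
  "lipschitz_retraction L X A r \<longleftrightarrow>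
     A \<subseteq> mspace X \<and> lipschitz_map L X (submetric X A) r \<and> (\<forall>a\<in>A. r a = a)"

definition lipschitz_retract :: "real \<Rightarrow> 'a metric \<Rightarrow> 'a set \<Rightarrow> bool" where
  "lipschitz_retract L X A \<longleftrightarrow> (\<exists>r. lipschitz_retraction L X A r)"

definition lipschitz_extensor_with :: "real \<Rightarrow> 'k metric \<Rightarrow> 'a metric \<Rightarrow> bool" where
  "lipschitz_extensor_with m K X \<longleftrightarrow>
     0 < m \<and>
     (\<forall>A f. A \<noteq> {} \<and> closedin (mtopology_of X) A \<and>
            Lipschitz_continuous_map (submetric X A) K f \<longrightarrow>
        (\<exists>F. Lipschitz_continuous_map X K F \<and> (\<forall>a\<in>A. F a = f a) \<and>
             Lip X K F \<le> m * Lip (submetric X A) K f))"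

definition lipschitz_extensor :: "'k metric \<Rightarrow> 'a metric \<Rightarrow> bool" where
  "lipschitz_extensor K X \<longleftrightarrow> (\<exists>m. lipschitz_extensor_with m K X)"

definition S0 :: "real metric" where
  "S0 = submetric euclidean_metric {-1, 1}"

section \<open>Metrically proper maps\<close>

definition bounded_in :: "'a metric \<Rightarrow> 'a set \<Rightarrow> bool" where
  "bounded_in X = Metric_space.mbounded (mspace X) (mdist X)"

definition metrically_proper :: "'a metric \<Rightarrow> 'b metric \<Rightarrow> ('a \<Rightarrow> 'b) \<Rightarrow> bool" where
  "metrically_proper X Y f \<longleftrightarrow>
     f \<in> mspace X \<rightarrow> mspace Y \<and>
     (\<forall>B. bounded_in Y B \<longrightarrow> bounded_in X {x \<in> mspace X. f x \<in> B})"

definition proper_extension_property :: "real \<Rightarrow> 'k metric \<Rightarrow> 'a metric \<Rightarrow> bool" where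
  "proper_extension_property L Y X \<longleftrightarrow>
     (\<forall>A f. closedin (mtopology_of X) A \<and> \<not> bounded_in X A \<and>
            Lipschitz_continuous_map (submetric X A) Y f \<and>
            metrically_proper (submetric X A) Y f \<longrightarrow>
        (\<exists>F. Lipschitz_continuous_map X Y F \<and> metrically_proper X Y F \<and>
             (\<forall>a\<in>A. F a = f a) \<and>
             Lip X Y F \<le> L * Lip (submetric X A) Y f))"

section \<open>Quantifying over all metric spaces\<close>

text \<open>A HOL formula cannot quantify over types, so "every metric space" is split in two.
  Inside an equivalence the targets range over all metric spaces with points in the type \<open>'a\<close>
  of the points of \<open>X\<close>. The theorem asserts separately that any constant valid for these
  targets is valid for all metric spaces with points in \<open>'k\<close>, where \<open>'k\<close> is a free type variable
  and hence arbitrary. Together these express one constant serving all metric spaces.\<close>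

definition all_extensors :: "'k itself \<Rightarrow> real \<Rightarrow> 'a metric \<Rightarrow> bool" where
  "all_extensors t L X \<longleftrightarrow> (\<forall>K :: 'k metric. lipschitz_extensor_with L K X)"

definition all_proper_extensions :: "'k itself \<Rightarrow> real \<Rightarrow> 'a metric \<Rightarrow> bool" where
  "all_proper_extensions t L X \<longleftrightarrow>
     (\<forall>Y :: 'k metric. \<not> bounded_in Y (mspace Y) \<longrightarrow> proper_extension_property L Y X)"

end

theory Submission
  imports Defs
begin

text \<open>
  Let \<open>\<rho>(x, y)\<close> be the infimum of the scales \<open>S\<close> at which \<open>x\<close> and \<open>y\<close> are joined by an
  \<open>S\<close>-chain. It is an ultrametric on \<open>X\<close> with \<open>\<rho> \<le> d\<close>, and \<open>dim\<^sub>A\<^sub>N X \<le> 0\<close> says that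
  \<open>d \<le> m \<rho>\<close>. In an ultrametric space, sending each point outside a closed set \<open>A\<close> to a
  nearly closest point of \<open>A\<close>, with the choice depending only on the distances to \<open>A\<close>, is
  a \<open>2\<close>-Lipschitz retraction. It is proper if among the candidates one chooses a point nearly
  as far as possible from a base point. Composing with retractions extends Lipschitz maps, and
  extending identity maps gives retractions back.

  Conversely, a retraction onto \<open>{x} \<union> {z. d(x, z) \<ge> d(x, y)}\<close>, or an extension to \<open>X\<close> of an
  injective map \<open>{x, y} \<rightarrow> S\<^sup>0\<close>, has to jump somewhere along every \<open>S\<close>-chain from \<open>x\<close> to \<open>y\<close>,
  which bounds \<open>d(x, y)\<close> by a multiple of \<open>S\<close>.
\<close>

section \<open>Lipschitz constants\<close>

lemma Lip_le:
  assumes "lipschitz_map L X Y f"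
  shows "Lip X Y f \<le> L"
  unfolding Lip_def
  by (rule cInf_lower) (use assms in \<open>auto intro!: bdd_belowI[of _ 0] simp: lipschitz_map_def\<close>)

text \<open>For a fixed pair of points the Lipschitz inequality is a closed condition on the
  constant, so it passes to the infimum. Pairs at distance \<open>0\<close> are treated apart
  because the argument divides by the distance.\<close>

lemma lipschitz_map_Lip:
  assumes "lipschitz_map L X Y f"
  shows "lipschitz_map (Lip X Y f) X Y f"
proof -
  let ?C = "{L. lipschitz_map L X Y f}"
  have ne: "?C \<noteq> {}" using assms by auto
  have "0 \<le> Inf ?C"
    by (rule cInf_greatest[OF ne]) (auto simp: lipschitz_map_def)
  moreover have "mdist Y (f x) (f y) \<le> Inf ?C * mdist X x y"
    if "x \<in> mspace X" "y \<in> mspace X" for x y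
  proof (cases "mdist X x y = 0")
    case True
    moreover have "mdist Y (f x) (f y) \<le> L * mdist X x y"
      using assms that by (auto simp: lipschitz_map_def)
    ultimately show ?thesis by simp
  next
    case False
    then have pos: "mdist X x y > 0" using mdist_nonneg[of X x y] by linarith
    have "mdist Y (f x) (f y) / mdist X x y \<le> Inf ?C"
      by (rule cInf_greatest[OF ne])
        (use that pos in \<open>auto simp: lipschitz_map_def pos_divide_le_eq\<close>)
    then show ?thesis using pos by (simp add: pos_divide_le_eq)
  qed
  ultimately show ?thesis
    using assms unfolding lipschitz_map_def Lip_def by blast
qed

lemma lipschitz_map_mono:
  assumes "lipschitz_map L X Y f" "L \<le> L'"
  shows "lipschitz_map L' X Y f"
  unfolding lipschitz_map_def
proof (intro conjI ballI)
  fix x y assume "x \<in> mspace X" "y \<in> mspace X"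
  then have "mdist Y (f x) (f y) \<le> L * mdist X x y"
    using assms(1) by (auto simp: lipschitz_map_def)
  also have "\<dots> \<le> L' * mdist X x y" by (intro mult_right_mono assms(2) mdist_nonneg)
  finally show "mdist Y (f x) (f y) \<le> L' * mdist X x y" .
qed (use assms in \<open>auto simp: lipschitz_map_def\<close>)

text \<open>The library's notion admits negative constants; replacing \<open>B\<close> by
  \<open>max B 0\<close> preserves the inequality.\<close>

lemma Lipschitz_continuous_map_eq_lipschitz_map:
  "Lipschitz_continuous_map X Y f \<longleftrightarrow> (\<exists>L. lipschitz_map L X Y f)"
proof
  assume "Lipschitz_continuous_map X Y f"
  then obtain B where B: "f \<in> mspace X \<rightarrow> mspace Y"
    "\<And>x y. x \<in> mspace X \<Longrightarrow> y \<in> mspace X \<Longrightarrow> mdist Y (f x) (f y) \<le> B * mdist X x y"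
    unfolding Lipschitz_continuous_map_def by blast
  have "B * mdist X x y \<le> max B 0 * mdist X x y" for x y
    by (rule mult_right_mono) auto
  then have "lipschitz_map (max B 0) X Y f"
    unfolding lipschitz_map_def using B(1) B(2)[THEN order_trans] by auto
  then show "\<exists>L. lipschitz_map L X Y f" ..
qed (auto simp: lipschitz_map_def Lipschitz_continuous_map_def)

lemma lipschitz_map_compose:
  assumes f: "lipschitz_map L X Y f" and g: "lipschitz_map L' Y Z g"
  shows "lipschitz_map (L * L') X Z (g \<circ> f)"
  unfolding lipschitz_map_def
proof (intro conjI ballI)
  fix x y assume xy: "x \<in> mspace X" "y \<in> mspace X"
  then have "mdist Z (g (f x)) (g (f y)) \<le> L' * mdist Y (f x) (f y)"
    using assms unfolding lipschitz_map_def by blast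
  also have "\<dots> \<le> L' * (L * mdist X x y)"
    using assms xy unfolding lipschitz_map_def by (intro mult_left_mono) auto
  finally show "mdist Z ((g \<circ> f) x) ((g \<circ> f) y) \<le> L * L' * mdist X x y"
    by (simp add: algebra_simps)
qed (use assms in \<open>auto simp: lipschitz_map_def\<close>)

lemma lipschitz_map_id: "lipschitz_map 1 X X id"
  by (simp add: lipschitz_map_def)

section \<open>Bounded sets and proper maps\<close>

lemma bounded_in_alt:
  "bounded_in X U \<longleftrightarrow> U \<subseteq> mspace X \<and> (\<exists>B. \<forall>x\<in>U. \<forall>y\<in>U. mdist X x y \<le> B)"
  unfolding bounded_in_def by (rule Metric_space.mbounded_alt) simp

lemma bounded_in_submetric:
  "bounded_in (submetric X A) U \<longleftrightarrow> U \<subseteq> A \<and> bounded_in X U"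
  unfolding bounded_in_alt by auto

lemma bounded_inI:
  assumes "p \<in> mspace X" "U \<subseteq> mspace X" "\<And>x. x \<in> U \<Longrightarrow> mdist X p x \<le> B"
  shows "bounded_in X U"
  unfolding bounded_in_def Metric_space.mbounded_def[OF Metric_space_mspace_mdist]
    Metric_space.mcball_def[OF Metric_space_mspace_mdist]
  using assms by blast

lemma bounded_inD:
  assumes "bounded_in X U" "p \<in> mspace X"
  obtains B where "\<And>x. x \<in> U \<Longrightarrow> mdist X p x \<le> B"
proof (cases "U = {}")
  case False
  then obtain u where u: "u \<in> U" by blast
  obtain B where B: "U \<subseteq> mspace X" "\<And>x. x \<in> U \<Longrightarrow> mdist X u x \<le> B"
    using assms u unfolding bounded_in_alt by blast
  have "mdist X p x \<le> mdist X p u + B" if "x \<in> U" for x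
    using mdist_triangle[of p X u x] B u that assms(2) by fastforce
  then show ?thesis by (rule that)
qed (use that in auto)

lemma unbounded_two_points:
  assumes "\<not> bounded_in X A" "A \<subseteq> mspace X"
  obtains x y where "x \<in> A" "y \<in> A" "0 < mdist X x y"
  using assms mdist_nonneg unfolding bounded_in_alt by (metis linorder_not_le)

lemma metrically_proper_compose:
  assumes "metrically_proper X Y f" "metrically_proper Y Z g"
  shows "metrically_proper X Z (g \<circ> f)"
proof -
  have *: "{x \<in> mspace X. (g \<circ> f) x \<in> B} = {x \<in> mspace X. f x \<in> {y \<in> mspace Y. g y \<in> B}}" for B
    using assms by (auto simp: metrically_proper_def)
  show ?thesis
    unfolding metrically_proper_def * using assms by (auto simp: metrically_proper_def)
qed

lemma metrically_proper_id: "metrically_proper X X id"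
  by (auto simp: metrically_proper_def bounded_in_alt)

section \<open>Chains\<close>

definition chain_step :: "'a metric \<Rightarrow> real \<Rightarrow> 'a set \<Rightarrow> 'a \<Rightarrow> 'a \<Rightarrow> bool" where
  "chain_step X S U u v \<longleftrightarrow> u \<in> U \<and> v \<in> U \<and> mdist X u v \<le> S"

text \<open>Paths of a relation replace lists, so that concatenation, reversal and monotonicity of
  chains come from the closure operator. The closure is reflexive also outside \<open>U\<close>,
  hence the conjunct \<open>x \<in> U\<close>.\<close>

lemma chain_joins_iff_rtranclp:
  "chain_joins X S U x y \<longleftrightarrow> x \<in> U \<and> (chain_step X S U)\<^sup>*\<^sup>* x y"
proof
  assume "chain_joins X S U x y"
  then obtain xs where "xs \<noteq> []" "set xs \<subseteq> U" "hd xs = x" "last xs = y"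
    "successively (\<lambda>u v. mdist X u v \<le> S) xs"
    unfolding chain_joins_def by blast
  then show "x \<in> U \<and> (chain_step X S U)\<^sup>*\<^sup>* x y"
  proof (induction xs arbitrary: x)
    case (Cons a xs)
    show ?case
    proof (cases xs)
      case Nil
      then show ?thesis using Cons.prems by auto
    next
      case (Cons b ys)
      then have "(chain_step X S U)\<^sup>*\<^sup>* b y"
        using Cons.IH[of b] Cons.prems by simp
      moreover have "chain_step X S U a b"
        using Cons Cons.prems by (simp add: chain_step_def)
      ultimately show ?thesis using Cons.prems by (auto intro: converse_rtranclp_into_rtranclp)
    qed
  qed simp
next
  assume "x \<in> U \<and> (chain_step X S U)\<^sup>*\<^sup>* x y"
  then have "(chain_step X S U)\<^sup>*\<^sup>* x y" "x \<in> U" by auto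
  then show "chain_joins X S U x y"
  proof (induction rule: converse_rtranclp_induct)
    case base
    then show ?case unfolding chain_joins_def by (intro exI[of _ "[y]"]) auto
  next
    case (step u v)
    then obtain xs where xs: "xs \<noteq> []" "set xs \<subseteq> U" "hd xs = v" "last xs = y"
      "successively (\<lambda>u v. mdist X u v \<le> S) xs"
      unfolding chain_joins_def chain_step_def by blast
    then show ?case
      unfolding chain_joins_def using step
      by (intro exI[of _ "u # xs"]) (auto simp: successively_Cons chain_step_def)
  qed
qed

lemma chain_step_rtranclp_sym:
  "(chain_step X S U)\<^sup>*\<^sup>* x y \<Longrightarrow> (chain_step X S U)\<^sup>*\<^sup>* y x"
  by (rule sympD[OF symp_rtranclp]) (auto simp: symp_def chain_step_def mdist_commute)

lemma chain_step_rtranclp_mono: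
  assumes "(chain_step X S U)\<^sup>*\<^sup>* x y" "S \<le> S'" "U \<subseteq> U'"
  shows "(chain_step X S' U')\<^sup>*\<^sup>* x y"
  using assms(1) by (rule rtranclp_mono[THEN predicate2D, rotated])
    (use assms(2,3) in \<open>auto simp: chain_step_def\<close>)

text \<open>Discrete intermediate value principle. Applied to chain steps, it locates the jump that
  bounds the distance between the ends of a chain.\<close>

lemma rtranclp_crossing:
  assumes "R\<^sup>*\<^sup>* x y" "P x" "\<not> P y"
  obtains u v where "R u v" "P u" "\<not> P v"
  using assms by (induction rule: rtranclp_induct) blast+

text \<open>An \<open>S\<close>-connected set containing \<open>x\<close> has only points reachable
  from \<open>x\<close>, which gives maximality. Connectedness holds because all points of a chain
  starting at \<open>x\<close> are reachable themselves, so the chain stays in the set.\<close>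

lemma scale_component_reachable:
  assumes "x \<in> mspace X"
  shows "scale_component X S {z. (chain_step X S (mspace X))\<^sup>*\<^sup>* x z}"
    (is "scale_component X S ?U")
proof -
  have sub: "?U \<subseteq> mspace X"
    using assms by (auto elim: rtranclp.cases simp: chain_step_def)
  have inU: "(chain_step X S ?U)\<^sup>*\<^sup>* x z" if "z \<in> ?U" for z
  proof -
    from that have "(chain_step X S (mspace X))\<^sup>*\<^sup>* x z" by simp
    then show ?thesis
    proof (induction rule: rtranclp_induct)
      case (step y z)
      then have "chain_step X S ?U y z"
        by (auto simp: chain_step_def intro: rtranclp.rtrancl_into_rtrancl)
      then show ?case using step by (auto intro: rtranclp.rtrancl_into_rtrancl)
    qed simp
  qed
  then have "scale_connected X S ?U"
    unfolding scale_connected_def chain_joins_iff_rtranclp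
    using sub by (metis chain_step_rtranclp_sym rtranclp_trans)
  moreover have "V = ?U" if V: "scale_connected X S V" "?U \<subseteq> V" for V
  proof
    have "x \<in> V" using V(2) by auto
    then show "V \<subseteq> ?U"
      using V(1) unfolding scale_connected_def chain_joins_iff_rtranclp
      by (auto intro: chain_step_rtranclp_mono)
  qed (rule V)
  ultimately show ?thesis unfolding scale_component_def by blast
qed

section \<open>The ultrametric of chain scales\<close>

text \<open>This is the subdominant ultrametric: the largest ultrametric pseudodistance below the
  metric. The condition \<open>0 < S\<close> matches the scales in \<open>AN_dim_le_0\<close> and
  bounds the set from below.\<close>

definition chain_scale :: "'a metric \<Rightarrow> 'a \<Rightarrow> 'a \<Rightarrow> real" where
  "chain_scale X x y = Inf {S. 0 < S \<and> (chain_step X S (mspace X))\<^sup>*\<^sup>* x y}"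

lemma chain_scale_le:
  assumes "0 < S" "(chain_step X S (mspace X))\<^sup>*\<^sup>* x y"
  shows "chain_scale X x y \<le> S"
  unfolding chain_scale_def
  by (rule cInf_lower) (use assms in \<open>auto intro: bdd_belowI[of _ 0]\<close>)

lemma chain_scale_le_mdist:
  assumes "x \<in> mspace X" "y \<in> mspace X"
  shows "chain_scale X x y \<le> mdist X x y"
proof (rule field_le_epsilon)
  fix e :: real assume e: "0 < e"
  show "chain_scale X x y \<le> mdist X x y + e"
    by (rule chain_scale_le)
      (use assms e in \<open>auto simp: chain_step_def intro!: add_nonneg_pos r_into_rtranclp\<close>)
qed

lemma ex_chain_step:
  assumes "x \<in> mspace X" "y \<in> mspace X"
  shows "{S. 0 < S \<and> (chain_step X S (mspace X))\<^sup>*\<^sup>* x y} \<noteq> {}"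
proof -
  have "(chain_step X (mdist X x y + 1) (mspace X))\<^sup>*\<^sup>* x y"
    using assms by (auto simp: chain_step_def)
  moreover have "0 < mdist X x y + 1" by (simp add: add_nonneg_pos)
  ultimately show ?thesis by blast
qed

lemma chain_scale_nonneg:
  assumes "x \<in> mspace X" "y \<in> mspace X"
  shows "0 \<le> chain_scale X x y"
  unfolding chain_scale_def by (rule cInf_greatest[OF ex_chain_step[OF assms]]) auto

lemma chain_scale_less:
  assumes "x \<in> mspace X" "y \<in> mspace X" "chain_scale X x y < e"
  shows "(chain_step X e (mspace X))\<^sup>*\<^sup>* x y"
  using cInf_lessD[OF ex_chain_step[OF assms(1,2)], of e] assms(3)
  by (auto simp: chain_scale_def intro: chain_step_rtranclp_mono)

lemma chain_scale_commute: "chain_scale X x y = chain_scale X y x"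
  unfolding chain_scale_def by (metis chain_step_rtranclp_sym)

text \<open>Concatenating two chains gives a chain at the larger of their scales; the slack
  \<open>e\<close> is there because the infimum need not be attained.\<close>

lemma chain_scale_ultra:
  assumes "x \<in> mspace X" "y \<in> mspace X" "z \<in> mspace X"
  shows "chain_scale X x z \<le> max (chain_scale X x y) (chain_scale X y z)"
proof (rule field_le_epsilon)
  fix e :: real assume "0 < e"
  define S where "S = max (chain_scale X x y) (chain_scale X y z) + e"
  have *: "chain_scale X x y < S" "chain_scale X y z < S"
    using \<open>0 < e\<close> by (auto simp: S_def)
  then have "(chain_step X S (mspace X))\<^sup>*\<^sup>* x z"
    using assms by (meson chain_scale_less rtranclp_trans)
  moreover have "0 < S" using chain_scale_nonneg[OF assms(1,2)] * by linarith
  ultimately show "chain_scale X x z \<le> S" by (intro chain_scale_le)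
qed

text \<open>The ends of an \<open>S\<close>-chain lie in one \<open>S\<close>-component, so they are
  at most \<open>m * S\<close> apart, and this bound passes to the infimum over
  \<open>S\<close>.\<close>

lemma mdist_le_chain_scale:
  assumes m: "\<And>S U. 0 < S \<Longrightarrow> scale_component X S U \<Longrightarrow> bounded_by X (m * S) U" "1 \<le> m"
    and xy: "x \<in> mspace X" "y \<in> mspace X"
  shows "mdist X x y \<le> m * chain_scale X x y"
proof -
  have "mdist X x y / m \<le> chain_scale X x y"
    unfolding chain_scale_def
  proof (rule cInf_greatest[OF ex_chain_step[OF xy]])
    fix S assume "S \<in> {S. 0 < S \<and> (chain_step X S (mspace X))\<^sup>*\<^sup>* x y}"
    then have "mdist X x y \<le> m * S"
      using m(1)[OF _ scale_component_reachable[OF xy(1), of S]] by (auto simp: bounded_by_def)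
    then show "mdist X x y / m \<le> S" using m(2) by (simp add: divide_simps mult.commute)
  qed
  then show ?thesis using m(2) by (simp add: divide_simps mult.commute)
qed

section \<open>Retractions in ultrametric spaces\<close>

text \<open>The last property of \<open>r\<close> makes it proper when \<open>A\<close> is unbounded.\<close>

lemma ultrametric_retraction:
  fixes \<rho> :: "'a \<Rightarrow> 'a \<Rightarrow> real"
  assumes nonneg: "\<And>x y. x \<in> M \<Longrightarrow> y \<in> M \<Longrightarrow> 0 \<le> \<rho> x y"
    and zero: "\<And>x. x \<in> M \<Longrightarrow> \<rho> x x = 0"
    and sym: "\<And>x y. \<rho> x y = \<rho> y x"
    and ultra: "\<And>x y z. x \<in> M \<Longrightarrow> y \<in> M \<Longrightarrow> z \<in> M \<Longrightarrow> \<rho> x z \<le> max (\<rho> x y) (\<rho> y z)"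
    and A: "A \<subseteq> M" "p \<in> A"
    and sep: "\<And>x. x \<in> M \<Longrightarrow> x \<notin> A \<Longrightarrow> \<exists>e>0. \<forall>a\<in>A. e \<le> \<rho> x a"
  obtains r where "r \<in> M \<rightarrow> A" "\<And>a. a \<in> A \<Longrightarrow> r a = a"
    "\<And>x y. x \<in> M \<Longrightarrow> y \<in> M \<Longrightarrow> \<rho> (r x) (r y) \<le> 2 * \<rho> x y"
    "\<And>x a. x \<in> M \<Longrightarrow> a \<in> A \<Longrightarrow> \<rho> p a \<le> \<rho> p x \<Longrightarrow> \<rho> p a \<le> 2 * \<rho> p (r x)"
proof -
  define t where "t x = Inf (\<rho> x ` A)" for x
  \<comment> \<open>Since \<open>p \<in> A\<close>, \<open>Q x a\<close> depends on \<open>x\<close>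
    only through its distances to points of \<open>A\<close>. The last clause asks that
    \<open>a\<close> be, up to a factor \<open>2\<close>, as far from \<open>p\<close> as any point
    of \<open>A\<close> that is no farther from \<open>p\<close> than \<open>x\<close>.\<close>
  define Q where "Q x a \<longleftrightarrow> a \<in> A \<and> \<rho> x a \<le> 2 * t x \<and>
    (\<forall>a'\<in>A. \<rho> p a' \<le> \<rho> p x \<longrightarrow> \<rho> p a' \<le> 2 * \<rho> p a)" for x a
  define r where "r x = (if x \<in> A then x else SOME a. Q x a)" for x
  have AM: "a \<in> M" if "a \<in> A" for a using A that by auto
  have pM: "p \<in> M" using A by auto
  \<comment> \<open>In an ultrametric triangle the two longest sides have equal length.\<close>
  have isosceles: "\<rho> x z = \<rho> y z" if "x \<in> M" "y \<in> M" "z \<in> M" "\<rho> x y < \<rho> x z" for x y z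
    using ultra[of x y z] ultra[of y x z] sym[of x y] that by auto
  have t_le: "t x \<le> \<rho> x a" if "x \<in> M" "a \<in> A" for x a
    unfolding t_def
    by (rule cInf_lower) (use that nonneg AM in \<open>auto intro!: bdd_belowI[of _ 0]\<close>)
  have ex_Q: "\<exists>a. Q x a" if x: "x \<in> M" "x \<notin> A" for x
  proof -
    \<comment> \<open>The gap makes \<open>t x\<close> positive, which leaves room for a point of
      \<open>A\<close> at distance below \<open>2 * t x\<close>.\<close>
    obtain e where e: "e > 0" "\<And>a. a \<in> A \<Longrightarrow> e \<le> \<rho> x a" using sep[OF x] by blast
    have "e \<le> t x" unfolding t_def by (rule cInf_greatest) (use A e in auto)
    then have "Inf (\<rho> x ` A) < 2 * t x" using e(1) unfolding t_def[symmetric] by linarith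
    then obtain a0 where a0: "a0 \<in> A" "\<rho> x a0 < 2 * t x"
      using cInf_lessD[of "\<rho> x ` A"] A by blast
    show ?thesis
    proof (cases "\<rho> x a0 < \<rho> x p")
      case True
      \<comment> \<open>So \<open>a0\<close> is exactly as far from \<open>p\<close> as
        \<open>x\<close> is, and the last clause of \<open>Q\<close> holds.\<close>
      then have "\<rho> p x = \<rho> p a0"
        using isosceles[of x a0 p] x AM[OF a0(1)] pM sym by auto
      then have "Q x a0"
        unfolding Q_def using a0 nonneg[OF pM AM[OF a0(1)]] by auto
      then show ?thesis ..
    next
      case False
      \<comment> \<open>Now \<open>p\<close> is at most as far from \<open>x\<close> as
        \<open>a0\<close>, so every point of \<open>A\<close> no farther from \<open>p\<close> than
        \<open>x\<close> lies within \<open>2 * t x\<close> of \<open>x\<close>. Among these one is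
        free to choose a point nearly farthest from \<open>p\<close>.\<close>
      define G where "G = {\<rho> p a | a. a \<in> A \<and> \<rho> p a \<le> \<rho> p x}"
      have bdd: "bdd_above G" unfolding G_def by (auto intro: bdd_aboveI[of _ "\<rho> p x"])
      have upper: "\<rho> p a \<le> Sup G" if "a \<in> A" "\<rho> p a \<le> \<rho> p x" for a
        by (rule cSup_upper[OF _ bdd]) (use that in \<open>auto simp: G_def\<close>)
      have p_le: "\<rho> p p \<le> \<rho> p x" using zero[OF pM] nonneg[OF pM x(1)] by auto
      \<comment> \<open>The supremum need not be attained, but if it is positive then its half is
        exceeded; otherwise \<open>p\<close> itself serves.\<close>
      obtain a where a: "a \<in> A" "\<rho> p a \<le> \<rho> p x" "Sup G \<le> 2 * \<rho> p a"
      proof (cases "Sup G \<le> 0")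
        case True
        then show ?thesis using that[of p] A(2) p_le zero[OF pM] by auto
      next
        case False
        then have "Sup G / 2 < Sup G" by simp
        moreover have "G \<noteq> {}" using A(2) p_le by (auto simp: G_def)
        ultimately obtain g where "g \<in> G" "Sup G / 2 < g"
          using less_cSup_iff[OF _ bdd] by blast
        then show ?thesis using that unfolding G_def by auto
      qed
      have "\<rho> x a \<le> 2 * t x"
        using ultra[OF x(1) pM AM[OF a(1)]] a(2) a0(2) False sym[of x p] by auto
      then have "Q x a" unfolding Q_def using a upper by fastforce
      then show ?thesis ..
    qed
  qed
  then have Qr: "Q x (r x)" if "x \<in> M" "x \<notin> A" for x
    using that by (auto simp: r_def intro: someI_ex)
  have rA: "r x \<in> A" if "x \<in> M" for x
    using Qr[OF that] by (cases "x \<in> A") (auto simp: r_def Q_def)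
  \<comment> \<open>Within distance \<open>t x\<close> of \<open>x\<close> all distances to points
    of \<open>A\<close> are the same as from \<open>x\<close>, so the predicates \<open>Q x\<close>
    and \<open>Q y\<close> coincide and \<open>SOME\<close> returns the same point.\<close>
  have r_cong: "r x = r y" if "x \<in> M" "y \<in> M" "x \<notin> A" "\<rho> x y < t x" for x y
  proof -
    have "y \<notin> A" using t_le[OF that(1), of y] that by auto
    have eq: "\<rho> x a = \<rho> y a" if "a \<in> A" for a
      using isosceles[of x y a] t_le[of x a] that AM \<open>x \<in> M\<close> \<open>y \<in> M\<close> \<open>\<rho> x y < t x\<close> by force
    then have "\<rho> x ` A = \<rho> y ` A" by auto
    then have "t x = t y" by (simp add: t_def)
    moreover have "\<rho> p x = \<rho> p y" using eq[OF A(2)] sym by auto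
    ultimately have "Q x = Q y" using eq unfolding Q_def by auto
    then show ?thesis using \<open>x \<notin> A\<close> \<open>y \<notin> A\<close> by (simp add: r_def)
  qed
  \<comment> \<open>If the images differ and \<open>x \<notin> A\<close>, then
    \<open>t x \<le> \<rho> x y\<close>, and \<open>x\<close> is moved by at most
    \<open>2 * t x\<close>.\<close>
  have near: "\<rho> x (r x) \<le> 2 * \<rho> x y" if "x \<in> M" "y \<in> M" "r x \<noteq> r y" for x y
  proof (cases "x \<in> A")
    case True
    then show ?thesis using zero nonneg that by (simp add: r_def)
  next
    case False
    then have "t x \<le> \<rho> x y" using r_cong that by force
    then show ?thesis using Qr[OF that(1) False] by (auto simp: Q_def)
  qed
  show thesis
  proof (rule that[of r])
    show "r \<in> M \<rightarrow> A" using rA by auto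
    show "r a = a" if "a \<in> A" for a using that by (simp add: r_def)
    show "\<rho> (r x) (r y) \<le> 2 * \<rho> x y" if xy: "x \<in> M" "y \<in> M" for x y
    proof (cases "r x = r y")
      case True
      then show ?thesis using zero nonneg rA AM xy by simp
    next
      case False
      \<comment> \<open>Along \<open>r x\<close>, \<open>x\<close>, \<open>y\<close>,
        \<open>r y\<close> the ultrametric inequality takes a maximum instead of a sum, so the
        factor \<open>2\<close> does not grow.\<close>
      have "\<rho> (r x) (r y) \<le> max (\<rho> (r x) x) (\<rho> x (r y))"
        using ultra rA AM xy by blast
      moreover have "\<rho> x (r y) \<le> max (\<rho> x y) (\<rho> y (r y))"
        using ultra rA AM xy by blast
      ultimately show ?thesis
        using near[OF xy False] near[OF xy(2,1)] False sym[of x y] sym[of x "r x"] nonneg[OF xy]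
        by auto
    qed
    show "\<rho> p a \<le> 2 * \<rho> p (r x)" if "x \<in> M" "a \<in> A" "\<rho> p a \<le> \<rho> p x" for x a
    proof (cases "x \<in> A")
      case True
      then show ?thesis using that nonneg[OF pM that(1)] by (simp add: r_def)
    next
      case False
      then show ?thesis using Qr[OF that(1) False] that by (auto simp: Q_def)
    qed
  qed
qed

text \<open>The metric and \<open>chain_scale X\<close> agree up to the factor \<open>m\<close>, so
  a \<open>2\<close>-Lipschitz retraction for the latter is \<open>2 * m\<close>-Lipschitz for the
  former, uniformly in \<open>A\<close>. The same map serves both categories, which is why
  properness is included.\<close>

lemma AN_dim_le_0_retraction:
  assumes "AN_dim_le_0 X"
  obtains L where "0 < L"
    "\<And>A. A \<noteq> {} \<Longrightarrow> closedin (mtopology_of X) A \<Longrightarrow>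
       \<exists>r. lipschitz_retraction L X A r \<and>
           (\<not> bounded_in X A \<longrightarrow> metrically_proper X (submetric X A) r)"
proof -
  obtain m where m: "1 \<le> m" "\<And>S U. 0 < S \<Longrightarrow> scale_component X S U \<Longrightarrow> bounded_by X (m * S) U"
    using assms unfolding AN_dim_le_0_def by blast
  let ?\<rho> = "chain_scale X"
  have d_le: "mdist X x y \<le> m * ?\<rho> x y" if "x \<in> mspace X" "y \<in> mspace X" for x y
    using mdist_le_chain_scale[OF m(2) m(1)] that by blast
  have "\<exists>r. lipschitz_retraction (2 * m) X A r \<and>
           (\<not> bounded_in X A \<longrightarrow> metrically_proper X (submetric X A) r)"
    if ne: "A \<noteq> {}" and closed: "closedin (mtopology_of X) A" for A
  proof -
    have AM: "A \<subseteq> mspace X" using closedin_subset[OF closed] by simp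
    obtain p where p: "p \<in> A" using ne by blast
    then have pM: "p \<in> mspace X" using AM by auto
    have sep: "\<exists>e>0. \<forall>a\<in>A. e \<le> ?\<rho> x a" if x: "x \<in> mspace X" "x \<notin> A" for x
    proof -
      \<comment> \<open>Closedness refers to the metric: a ball of radius \<open>e\<close> missing
        \<open>A\<close> becomes a gap of \<open>e / m\<close> for the chain scale.\<close>
      obtain e where e: "0 < e" "disjnt A (Metric_space.mball (mspace X) (mdist X) x e)"
        using closed x Metric_space.closedin_metric[OF Metric_space_mspace_mdist, of X]
        unfolding mtopology_of_def by blast
      have "e / m \<le> ?\<rho> x a" if a: "a \<in> A" for a
      proof -
        have "e \<le> mdist X x a"
          using e(2) a AM x
          by (force simp: disjnt_iff Metric_space.in_mball[OF Metric_space_mspace_mdist])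
        also have "\<dots> \<le> m * ?\<rho> x a" using d_le x a AM by auto
        finally show ?thesis using m(1) by (simp add: divide_simps mult.commute)
      qed
      then show ?thesis using e(1) m(1) by (intro exI[of _ "e / m"]) auto
    qed
    have zero: "?\<rho> x x = 0" if "x \<in> mspace X" for x
      using chain_scale_le_mdist[OF that that] chain_scale_nonneg[OF that that]
        mdist_zero[THEN iffD2, OF that that refl] by linarith
    obtain r where r: "r \<in> mspace X \<rightarrow> A" "\<And>a. a \<in> A \<Longrightarrow> r a = a"
      "\<And>x y. x \<in> mspace X \<Longrightarrow> y \<in> mspace X \<Longrightarrow> ?\<rho> (r x) (r y) \<le> 2 * ?\<rho> x y"
      "\<And>x a. x \<in> mspace X \<Longrightarrow> a \<in> A \<Longrightarrow> ?\<rho> p a \<le> ?\<rho> p x \<Longrightarrow> ?\<rho> p a \<le> 2 * ?\<rho> p (r x)"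
      by (rule ultrametric_retraction[of "mspace X" ?\<rho> A p,
            OF chain_scale_nonneg zero chain_scale_commute chain_scale_ultra AM p sep]) blast+
    have "lipschitz_map (2 * m) X (submetric X A) r"
      unfolding lipschitz_map_def
    proof (intro conjI ballI)
      fix x y assume xy: "x \<in> mspace X" "y \<in> mspace X"
      have "mdist X (r x) (r y) \<le> m * ?\<rho> (r x) (r y)"
        using d_le r(1) xy AM by blast
      also have "\<dots> \<le> m * (2 * mdist X x y)"
        using r(3)[OF xy] chain_scale_le_mdist[OF xy] m(1) by (intro mult_left_mono) auto
      finally show "mdist (submetric X A) (r x) (r y) \<le> 2 * m * mdist X x y" by simp
    qed (use r(1) AM m(1) in auto)
    then have "lipschitz_retraction (2 * m) X A r"
      unfolding lipschitz_retraction_def using AM r(2) by auto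
    moreover have "metrically_proper X (submetric X A) r" if unb: "\<not> bounded_in X A"
      unfolding metrically_proper_def
    proof (intro conjI allI impI)
      fix B assume "bounded_in (submetric X A) B"
      then obtain C where C: "\<And>b. b \<in> B \<Longrightarrow> mdist X p b \<le> C"
        using bounded_inD[OF _ pM] unfolding bounded_in_submetric by metis
      \<comment> \<open>The bound \<open>2 * m * C\<close> is chosen so that the chain scale from
        \<open>p\<close> to \<open>a\<close> exceeds \<open>2 * C\<close>. As it is at most
        \<open>C\<close> from \<open>p\<close> to a point \<open>r x\<close> of \<open>B\<close>,
        the contrapositive of \<open>r(4)\<close> confines \<open>x\<close>.\<close>
      obtain a where a: "a \<in> A" "2 * m * C < mdist X p a"
        using bounded_inI[OF pM AM, of "2 * m * C"] unb by force
      have "mdist X p x \<le> m * mdist X p a" if x: "x \<in> mspace X" "r x \<in> B" for x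
      proof -
        have "?\<rho> p (r x) \<le> C"
          using chain_scale_le_mdist[OF pM, of "r x"] C[OF x(2)] r(1) x(1) AM by fastforce
        moreover have "2 * C < ?\<rho> p a"
        proof -
          have "m * (2 * C) < m * ?\<rho> p a" using a d_le[OF pM, of a] AM by auto
          then show ?thesis using m(1) by simp
        qed
        ultimately have "?\<rho> p x \<le> ?\<rho> p a" using r(4)[OF x(1) a(1)] by linarith
        also have "\<dots> \<le> mdist X p a" using chain_scale_le_mdist[OF pM] a AM by auto
        finally have "m * ?\<rho> p x \<le> m * mdist X p a" using m(1) by (intro mult_left_mono) auto
        then show ?thesis using d_le[OF pM x(1)] by linarith
      qed
      then show "bounded_in X {x \<in> mspace X. r x \<in> B}"
        by (intro bounded_inI[OF pM]) auto
    qed (use r(1) AM in auto)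
    ultimately show ?thesis by blast
  qed
  then show thesis using m(1) by (intro that[of "2 * m"]) auto
qed

section \<open>Dimension zero from jumps along chains\<close>

text \<open>Chains inside a component are chains in the whole space. The witness
  \<open>max L 1\<close> meets the requirement \<open>1 \<le> m\<close> of
  \<open>AN_dim_le_0\<close>.\<close>

lemma AN_dim_le_0I:
  assumes "\<And>S x y. 0 < S \<Longrightarrow> x \<in> mspace X \<Longrightarrow> y \<in> mspace X \<Longrightarrow> x \<noteq> y \<Longrightarrow>
    (chain_step X S (mspace X))\<^sup>*\<^sup>* x y \<Longrightarrow> mdist X x y \<le> L * S"
  shows "AN_dim_le_0 X"
  unfolding AN_dim_le_0_def
proof (intro exI[of _ "max L 1"] conjI allI impI)
  fix S :: real and U assume S: "0 < S" and "scale_component X S U"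
  then have U: "U \<subseteq> mspace X" "\<And>x y. x \<in> U \<Longrightarrow> y \<in> U \<Longrightarrow> (chain_step X S U)\<^sup>*\<^sup>* x y"
    unfolding scale_component_def scale_connected_def chain_joins_iff_rtranclp by auto
  have "mdist X x y \<le> max L 1 * S" if "x \<in> U" "y \<in> U" for x y
  proof (cases "x = y")
    case True
    have "x \<in> mspace X" using U(1) that by auto
    then have "mdist X x y = 0" using True by simp
    then show ?thesis using S by simp
  next
    case False
    then have "mdist X x y \<le> L * S"
      using assms[OF S, of x y] U that by (auto intro: chain_step_rtranclp_mono)
    also have "\<dots> \<le> max L 1 * S" using S by (intro mult_right_mono) auto
    finally show ?thesis .
  qed
  then show "bounded_by X (max L 1 * S) U" using U(1) by (auto simp: bounded_by_def)
qed simp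

text \<open>The far points form the complement of an open ball, and singletons are closed. A
  retraction onto this set has to jump over the gap between \<open>x\<close> and the far
  points.\<close>

lemma closedin_insert_far_points:
  assumes "x \<in> mspace X"
  shows "closedin (mtopology_of X) (insert x {z \<in> mspace X. D \<le> mdist X x z})"
proof -
  interpret Metric_space "mspace X" "mdist X" by simp
  have "{z \<in> mspace X. D \<le> mdist X x z} = mspace X - mball x D"
    using assms by auto
  then have "closedin mtopology {z \<in> mspace X. D \<le> mdist X x z}"
    by (metis closedin_topspace openin_mball closedin_diff topspace_mtopology)
  moreover have "closedin mtopology {x}"
    using assms t1_space_closedin_singleton Hausdorff_imp_t1_space[OF Hausdorff_space_mtopology]
    by (metis topspace_mtopology)
  ultimately have "closedin mtopology ({x} \<union> {z \<in> mspace X. D \<le> mdist X x z})"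
    by (rule closedin_Un[rotated])
  then show ?thesis unfolding mtopology_of_def by simp
qed

text \<open>The condition that \<open>A\<close> be bounded only if the whole space is lets one lemma
  serve both categories: the test set omits only part of a ball, so it is unbounded whenever the
  space is.\<close>

lemma AN_dim_le_0_if_retracts:
  assumes "\<And>A. A \<noteq> {} \<Longrightarrow> closedin (mtopology_of X) A \<Longrightarrow>
    (bounded_in X A \<Longrightarrow> bounded_in X (mspace X)) \<Longrightarrow> lipschitz_retract L X A"
  shows "AN_dim_le_0 X"
proof (rule AN_dim_le_0I)
  fix S x y
  assume S: "0 < S" and x: "x \<in> mspace X" and y: "y \<in> mspace X" and "x \<noteq> y"
    and ch: "(chain_step X S (mspace X))\<^sup>*\<^sup>* x y"
  let ?D = "mdist X x y"
  let ?A = "insert x {z \<in> mspace X. ?D \<le> mdist X x z}"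
  have "bounded_in X (mspace X)" if bdd: "bounded_in X ?A"
  proof -
    obtain B where B: "\<And>z. z \<in> ?A \<Longrightarrow> mdist X x z \<le> B"
      using bounded_inD[OF bdd x] by blast
    have "mdist X x z \<le> max B ?D" if "z \<in> mspace X" for z
      using B[of z] that by fastforce
    then show ?thesis by (intro bounded_inI[OF x]) auto
  qed
  then have "lipschitz_retract L X ?A"
    by (intro assms closedin_insert_far_points[OF x]) auto
  then obtain r where r: "lipschitz_map L X (submetric X ?A) r" "\<And>a. a \<in> ?A \<Longrightarrow> r a = a"
    unfolding lipschitz_retract_def lipschitz_retraction_def by blast
  have "r x = x" "r y \<noteq> x" using r(2) y \<open>x \<noteq> y\<close> by auto
  \<comment> \<open>The value \<open>x\<close> is isolated in \<open>?A\<close> by the gap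
    \<open>?D\<close>, so a step on which \<open>r\<close> leaves it has images at least
    \<open>?D\<close> apart.\<close>
  then obtain u v where uv: "chain_step X S (mspace X) u v" "r u = x" "r v \<noteq> x"
    using rtranclp_crossing[OF ch, of "\<lambda>z. r z = x"] by blast
  then have "r v \<in> ?A" using r(1) by (auto simp: lipschitz_map_def chain_step_def)
  then have "?D \<le> mdist X (r u) (r v)" using uv by auto
  also have "\<dots> \<le> L * mdist X u v"
    using r(1) uv(1) by (auto simp: lipschitz_map_def chain_step_def)
  also have "\<dots> \<le> L * S"
    using r(1) uv(1) by (intro mult_left_mono) (auto simp: lipschitz_map_def chain_step_def)
  finally show "?D \<le> L * S" .
qed

text \<open>Separating \<open>x\<close> from \<open>y\<close> by the values \<open>-1\<close> and
  \<open>1\<close> has Lipschitz constant at most \<open>2 / mdist X x y\<close>. The extension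
  takes no other values, so it jumps by \<open>2\<close> on some step of every chain from
  \<open>x\<close> to \<open>y\<close>.\<close>

lemma AN_dim_le_0_if_S0_extensor:
  assumes "lipschitz_extensor S0 X"
  shows "AN_dim_le_0 X"
proof -
  obtain m where m: "lipschitz_extensor_with m S0 X"
    using assms unfolding lipschitz_extensor_def by blast
  show ?thesis
  proof (rule AN_dim_le_0I)
    fix S x y
    assume S: "0 < S" and x: "x \<in> mspace X" and y: "y \<in> mspace X" and "x \<noteq> y"
      and ch: "(chain_step X S (mspace X))\<^sup>*\<^sup>* x y"
    let ?D = "mdist X x y" and ?A = "{x, y}"
    define f :: "'a \<Rightarrow> real" where "f z = (if z = x then -1 else 1)" for z
    have D: "0 < ?D" using x y \<open>x \<noteq> y\<close> mdist_nonneg[of X x y] mdist_zero[of x X y] by linarith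
    have f: "lipschitz_map (2 / ?D) (submetric X ?A) S0 f"
      unfolding lipschitz_map_def S0_def using D x y \<open>x \<noteq> y\<close>
      by (auto simp: f_def dist_real_def mdist_commute)
    moreover have "closedin (mtopology_of X) ?A"
    proof -
      have "t1_space (mtopology_of X)"
        unfolding mtopology_of_def
        by (simp add: Metric_space.Hausdorff_space_mtopology Hausdorff_imp_t1_space)
      then show ?thesis using x y by (simp add: t1_space_closedin_finite)
    qed
    ultimately obtain F where F: "Lipschitz_continuous_map X S0 F" "\<And>a. a \<in> ?A \<Longrightarrow> F a = f a"
      "Lip X S0 F \<le> m * Lip (submetric X ?A) S0 f"
      using m unfolding lipschitz_extensor_with_def Lipschitz_continuous_map_eq_lipschitz_map
      by (metis insert_not_empty)
    have "0 < m" using m by (simp add: lipschitz_extensor_with_def)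
    then have "m * Lip (submetric X ?A) S0 f \<le> m * (2 / ?D)"
      by (intro mult_left_mono Lip_le[OF f]) auto
    then have F': "lipschitz_map (m * (2 / ?D)) X S0 F"
      using F lipschitz_map_Lip lipschitz_map_mono Lipschitz_continuous_map_eq_lipschitz_map
      by (metis order_trans)
    have "F x = -1" "F y \<noteq> -1" using F(2) \<open>x \<noteq> y\<close> by (auto simp: f_def)
    then obtain u v where uv: "chain_step X S (mspace X) u v" "F u = -1" "F v \<noteq> -1"
      using rtranclp_crossing[OF ch, of "\<lambda>z. F z = -1"] by blast
    then have "F v = 1" using F' by (auto simp: lipschitz_map_def chain_step_def S0_def)
    then have "2 = mdist S0 (F u) (F v)" using uv by (simp add: S0_def dist_real_def)
    also have "\<dots> \<le> m * (2 / ?D) * mdist X u v"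
      using F' uv(1) by (auto simp: lipschitz_map_def chain_step_def)
    also have "\<dots> \<le> m * (2 / ?D) * S"
      using D \<open>0 < m\<close> uv(1) by (intro mult_left_mono) (auto simp: chain_step_def)
    finally show "?D \<le> m * S" using D by (simp add: field_simps)
  qed
qed

section \<open>Retractions and extensions\<close>

lemma extension_by_retraction:
  assumes r: "lipschitz_retraction L X A r" and f: "Lipschitz_continuous_map (submetric X A) K f"
  shows "Lipschitz_continuous_map X K (f \<circ> r) \<and> (\<forall>a\<in>A. (f \<circ> r) a = f a) \<and>
    Lip X K (f \<circ> r) \<le> L * Lip (submetric X A) K f"
proof -
  have "lipschitz_map (L * Lip (submetric X A) K f) X K (f \<circ> r)"
    using r f lipschitz_map_compose lipschitz_map_Lip
    unfolding lipschitz_retraction_def Lipschitz_continuous_map_eq_lipschitz_map by metis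
  then show ?thesis
    using r Lip_le unfolding lipschitz_retraction_def Lipschitz_continuous_map_eq_lipschitz_map
    by fastforce
qed

text \<open>The identity of \<open>A\<close> has Lipschitz constant at most \<open>1\<close>; with
  \<open>0 \<le> L\<close>, its extension to \<open>X\<close> with values in \<open>A\<close> has
  constant at most \<open>L\<close>.\<close>

lemma retraction_by_extension:
  assumes F: "Lipschitz_continuous_map X (submetric X A) F" "\<forall>a\<in>A. F a = id a"
    and L: "Lip X (submetric X A) F \<le> L * Lip (submetric X A) (submetric X A) id" "0 \<le> L"
    and A: "A \<subseteq> mspace X"
  shows "lipschitz_retraction L X A F"
proof -
  have "Lip X (submetric X A) F \<le> L * 1"
    by (rule order_trans[OF L(1)]) (intro mult_left_mono Lip_le lipschitz_map_id L(2))
  then show ?thesis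
    using F A lipschitz_map_Lip lipschitz_map_mono
    unfolding lipschitz_retraction_def Lipschitz_continuous_map_eq_lipschitz_map by fastforce
qed

lemma Lipschitz_continuous_map_identity: "Lipschitz_continuous_map X X id"
  using lipschitz_map_id Lipschitz_continuous_map_eq_lipschitz_map by blast

lemma all_extensors_if_retracts:
  assumes "0 < L" "\<And>A. A \<noteq> {} \<Longrightarrow> closedin (mtopology_of X) A \<Longrightarrow> lipschitz_retract L X A"
  shows "all_extensors t L X"
  unfolding all_extensors_def lipschitz_extensor_with_def
proof (intro allI conjI impI; (elim conjE)?)
  fix K A f
  assume A: "A \<noteq> {}" "closedin (mtopology_of X) A"
    and f: "Lipschitz_continuous_map (submetric X A) K f"
  obtain r where "lipschitz_retraction L X A r"
    using assms(2)[OF A] unfolding lipschitz_retract_def by blast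
  from extension_by_retraction[OF this f]
  show "\<exists>F. Lipschitz_continuous_map X K F \<and> (\<forall>a\<in>A. F a = f a) \<and>
      Lip X K F \<le> L * Lip (submetric X A) K f" by blast
qed (rule assms)

lemma all_extensors_pos: "all_extensors t L X \<Longrightarrow> 0 < L"
  by (simp add: all_extensors_def lipschitz_extensor_with_def)

text \<open>The target is \<open>A\<close> itself, a metric space over the same type as
  \<open>X\<close>; this is why targets over \<open>'a\<close> suffice to recover
  retractions.\<close>

lemma retract_if_all_extensors:
  fixes X :: "'a metric"
  assumes ext: "all_extensors TYPE('a) L X" and A: "A \<noteq> {}" "closedin (mtopology_of X) A"
  shows "lipschitz_retract L X A"
proof -
  have "lipschitz_extensor_with L (submetric X A) X"
    using ext unfolding all_extensors_def by blast
  then obtain F where "Lipschitz_continuous_map X (submetric X A) F" "\<forall>a\<in>A. F a = id a"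
    "Lip X (submetric X A) F \<le> L * Lip (submetric X A) (submetric X A) id"
    unfolding lipschitz_extensor_with_def using A Lipschitz_continuous_map_identity[of "submetric X A"]
    by (elim conjE allE[of _ A] allE[of _ id]) blast
  then have "lipschitz_retraction L X A F"
    using retraction_by_extension all_extensors_pos[OF ext] closedin_subset[OF A(2)]
    by (metis less_imp_le topspace_mtopology_of)
  then show ?thesis unfolding lipschitz_retract_def by blast
qed

lemma all_proper_extensions_if_retracts:
  assumes retr: "\<And>A. closedin (mtopology_of X) A \<Longrightarrow> \<not> bounded_in X A \<Longrightarrow>
    \<exists>r. lipschitz_retraction L X A r \<and> metrically_proper X (submetric X A) r"
  shows "all_proper_extensions t L X"
  unfolding all_proper_extensions_def proper_extension_property_def
proof (intro allI impI; elim conjE)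
  fix Y A f
  assume A: "closedin (mtopology_of X) A" "\<not> bounded_in X A"
    and f: "Lipschitz_continuous_map (submetric X A) Y f" "metrically_proper (submetric X A) Y f"
  obtain r where "lipschitz_retraction L X A r" "metrically_proper X (submetric X A) r"
    using retr[OF A] by blast
  then show "\<exists>F. Lipschitz_continuous_map X Y F \<and> metrically_proper X Y F \<and>
      (\<forall>a\<in>A. F a = f a) \<and> Lip X Y F \<le> L * Lip (submetric X A) Y f"
    using extension_by_retraction[OF _ f(1)] metrically_proper_compose[OF _ f(2)] by blast
qed

lemma proper_retract_if_all_proper_extensions:
  fixes X :: "'a metric"
  assumes ext: "all_proper_extensions TYPE('a) L X"
    and A: "closedin (mtopology_of X) A" "\<not> bounded_in X A"
  shows "\<exists>r. lipschitz_retraction L X A r \<and> metrically_proper X (submetric X A) r"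
proof -
  let ?Y = "submetric X A"
  have AM: "A \<subseteq> mspace X" using closedin_subset[OF A(1)] by simp
  then have "\<not> bounded_in ?Y (mspace ?Y)"
    using A(2) by (simp add: bounded_in_submetric Int_absorb2)
  then have "proper_extension_property L ?Y X"
    using ext unfolding all_proper_extensions_def by blast
  then obtain F where F: "Lipschitz_continuous_map X ?Y F" "metrically_proper X ?Y F"
    "\<forall>a\<in>A. F a = id a" "Lip X ?Y F \<le> L * Lip ?Y ?Y id"
    unfolding proper_extension_property_def
    using A Lipschitz_continuous_map_identity[of ?Y] metrically_proper_id[of ?Y]
    by (elim allE[of _ A] allE[of _ id]) blast
  \<comment> \<open>The sign of \<open>L\<close> is not part of
    \<open>all_proper_extensions\<close>. Two points at positive distance make the Lipschitz
    constant of the identity of \<open>A\<close> positive, so \<open>F(4)\<close> forces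
    \<open>0 \<le> L\<close>.\<close>
  obtain x y where xy: "x \<in> A" "y \<in> A" "0 < mdist X x y"
    using unbounded_two_points[OF A(2) AM] by blast
  have "lipschitz_map (Lip ?Y ?Y id) ?Y ?Y id" by (rule lipschitz_map_Lip[OF lipschitz_map_id])
  then have "mdist X x y \<le> Lip ?Y ?Y id * mdist X x y"
    using xy(1,2) AM by (auto simp: lipschitz_map_def)
  then have "0 < Lip ?Y ?Y id * mdist X x y" using xy(3) by linarith
  then have "0 < Lip ?Y ?Y id" using xy(3) by (simp add: zero_less_mult_iff)
  moreover have "0 \<le> Lip X ?Y F"
    using F(1) lipschitz_map_Lip
    by (auto simp: Lipschitz_continuous_map_eq_lipschitz_map lipschitz_map_def[of "Lip _ _ _"])
  ultimately have "0 \<le> L"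
    using F(4) by (metis mult_neg_pos not_less order_trans)
  then show ?thesis using retraction_by_extension[OF F(1,3,4) _ AM] F(2) by blast
qed

theorem theorem3p5:
  fixes X :: "'a metric"
  assumes separable: "separable_space (mtopology_of X)"
  shows
    "(mspace X \<noteq> {} \<longrightarrow>
        (AN_dim_le_0 X \<longleftrightarrow>
           (\<exists>L. \<forall>A. A \<noteq> {} \<and> closedin (mtopology_of X) A \<longrightarrow> lipschitz_retract L X A)) \<and>
        (AN_dim_le_0 X \<longleftrightarrow> (\<exists>L. all_extensors TYPE('a) L X)) \<and>
        (\<forall>L. all_extensors TYPE('a) L X \<longrightarrow> all_extensors TYPE('k) L X) \<and>
        (AN_dim_le_0 X \<longleftrightarrow> lipschitz_extensor S0 X))
     \<and>
     (\<not> bounded_in X (mspace X) \<longrightarrow>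
        (AN_dim_le_0 X \<longleftrightarrow>
           (\<exists>L. \<forall>A. closedin (mtopology_of X) A \<and> \<not> bounded_in X A \<longrightarrow>
                (\<exists>r. lipschitz_retraction L X A r \<and> metrically_proper X (submetric X A) r))) \<and>
        (AN_dim_le_0 X \<longleftrightarrow> (\<exists>L. all_proper_extensions TYPE('a) L X)) \<and>
        (\<forall>L. all_proper_extensions TYPE('a) L X \<longrightarrow> all_proper_extensions TYPE('k) L X))"
proof (intro conjI impI)

  \<comment> \<open>Equivalences in the Lipschitz category\<close>
  have retracts: "\<exists>L>0. \<forall>A. A \<noteq> {} \<and> closedin (mtopology_of X) A \<longrightarrow> lipschitz_retract L X A"
    if "AN_dim_le_0 X"
    using AN_dim_le_0_retraction[OF that] unfolding lipschitz_retract_def by metis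
  have AN: "AN_dim_le_0 X"
    if "\<forall>A. A \<noteq> {} \<and> closedin (mtopology_of X) A \<longrightarrow> lipschitz_retract L X A" for L
    using that by (intro AN_dim_le_0_if_retracts) blast
  show "AN_dim_le_0 X \<longleftrightarrow>
      (\<exists>L. \<forall>A. A \<noteq> {} \<and> closedin (mtopology_of X) A \<longrightarrow> lipschitz_retract L X A)"
    using retracts AN by blast
  show "AN_dim_le_0 X \<longleftrightarrow> (\<exists>L. all_extensors TYPE('a) L X)"
  proof
    assume "\<exists>L. all_extensors TYPE('a) L X"
    then obtain L where "all_extensors TYPE('a) L X" ..
    then show "AN_dim_le_0 X" using retract_if_all_extensors by (intro AN[of L]) blast
  next
    assume "AN_dim_le_0 X"
    then obtain L where "0 < L"
      "\<forall>A. A \<noteq> {} \<and> closedin (mtopology_of X) A \<longrightarrow> lipschitz_retract L X A"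
      using retracts by blast
    then show "\<exists>L. all_extensors TYPE('a) L X"
      by (intro exI[of _ L] all_extensors_if_retracts) blast+
  qed
  \<comment> \<open>The constant is transferred through retractions: targets over \<open>'a\<close>
    give \<open>L\<close>-Lipschitz retractions, and composing with these extends maps into targets
    over \<open>'k\<close> with the same \<open>L\<close>.\<close>
  show "\<forall>L. all_extensors TYPE('a) L X \<longrightarrow> all_extensors TYPE('k) L X"
    by (intro allI impI all_extensors_if_retracts)
      (auto intro: all_extensors_pos retract_if_all_extensors)
  show "AN_dim_le_0 X \<longleftrightarrow> lipschitz_extensor S0 X"
  proof
    assume "AN_dim_le_0 X"
    then obtain L where "0 < L"
      "\<forall>A. A \<noteq> {} \<and> closedin (mtopology_of X) A \<longrightarrow> lipschitz_retract L X A"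
      using retracts by blast
    then have "all_extensors TYPE(real) L X"
      by (intro all_extensors_if_retracts) blast+
    then show "lipschitz_extensor S0 X"
      unfolding all_extensors_def lipschitz_extensor_def by blast
  qed (rule AN_dim_le_0_if_S0_extensor)
next

  \<comment> \<open>Equivalences in the proper Lipschitz category\<close>
  assume unb: "\<not> bounded_in X (mspace X)"
  let ?R = "\<lambda>L A. \<exists>r. lipschitz_retraction L X A r \<and> metrically_proper X (submetric X A) r"
  have proper_retracts:
    "\<exists>L. \<forall>A. closedin (mtopology_of X) A \<and> \<not> bounded_in X A \<longrightarrow> ?R L A" if AN: "AN_dim_le_0 X"
  proof -
    obtain L where L: "\<And>A. A \<noteq> {} \<Longrightarrow> closedin (mtopology_of X) A \<Longrightarrow>
       \<exists>r. lipschitz_retraction L X A r \<and>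
           (\<not> bounded_in X A \<longrightarrow> metrically_proper X (submetric X A) r)"
      using AN_dim_le_0_retraction[OF AN] by blast
    moreover have "A \<noteq> {}" if "\<not> bounded_in X A" for A
      using that by (auto simp: bounded_in_alt)
    ultimately show ?thesis by (intro exI[of _ L]) blast
  qed
  have AN: "AN_dim_le_0 X"
    if "\<forall>A. closedin (mtopology_of X) A \<and> \<not> bounded_in X A \<longrightarrow> ?R L A" for L
    using that unb by (intro AN_dim_le_0_if_retracts) (auto simp: lipschitz_retract_def)
  show "AN_dim_le_0 X \<longleftrightarrow>
      (\<exists>L. \<forall>A. closedin (mtopology_of X) A \<and> \<not> bounded_in X A \<longrightarrow> ?R L A)"
    using proper_retracts AN by blast
  show "AN_dim_le_0 X \<longleftrightarrow> (\<exists>L. all_proper_extensions TYPE('a) L X)"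
  proof
    assume "\<exists>L. all_proper_extensions TYPE('a) L X"
    then obtain L where "all_proper_extensions TYPE('a) L X" ..
    then show "AN_dim_le_0 X"
      using proper_retract_if_all_proper_extensions by (intro AN[of L]) blast
  next
    assume "AN_dim_le_0 X"
    then obtain L where "\<forall>A. closedin (mtopology_of X) A \<and> \<not> bounded_in X A \<longrightarrow> ?R L A"
      using proper_retracts by blast
    then show "\<exists>L. all_proper_extensions TYPE('a) L X"
      by (intro exI[of _ L] all_proper_extensions_if_retracts) blast
  qed
  show "\<forall>L. all_proper_extensions TYPE('a) L X \<longrightarrow> all_proper_extensions TYPE('k) L X"
    using all_proper_extensions_if_retracts proper_retract_if_all_proper_extensions by blast
qed

end
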